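(* Let $k\ge2$ and $n\ge1$. The total weight $T_{n+1}$ of all $k$-plane recursive trees of order $n+1$ equals the number $Q_n=\prod_{i=1}^{n-1}(ki+1)$ of $k$-Stirling permutations of order $n$. Moreover, the number of leaves of a random $k$-plane recursive tree of order $n+1$ has the same distribution as the number $X_n$ of ascents (equivalently, of descents) of a uniformly random $k$-Stirling permutation of order $n$.
   Context: A $k$-Stirling permutation of order $n$ is a word $a_1\cdots a_{kn}$ in which each of $1,\dots,n$ occurs exactly $k$ times, such that for each $i$ every entry between two occurrences of $i$ is at least $i$. With $a_0=a_{kn+1}=0$, an index $i\in\{0,\dots,kn\}$ is an ascent if $a_i<a_{i+1}$ and a descent if $a_i>a_{i+1}$; $X_n$ is the number of ascents. A $k$-plane recursive tree of order $m$ is an increasing plane tree on $\{1,\dots,m\}$ (rooted at $1$, labels increasing along paths away from the root, children of each vertex linearly ordered), weighted by $\prod_{v}\varphi_{d(v)}$ where $d(v)$ is the out-degree of $v$ and $\varphi_d=\frac{1}{d!}\prod_{l=1}^{d}\bigl((k-1)(l-1)+1\bigr)$ (i.e. $\sum_d\varphi_dt^d=(1-(k-1)t)^{-1/(k-1)}$). $T_m$ is the sum of the weights of all such trees of order $m$, and a random $k$-plane recursive tree of order $m$ is chosen with probability proportional to its weight. A leaf is a vertex of out-degree $0$. *)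

theory Defs
  imports "HOL-Probability.Probability"
begin

subsection \<open>Stirling permutations\<close>

definition stirling_perms :: "nat \<Rightarrow> nat \<Rightarrow> nat list set" where
  "stirling_perms k n = {w. set w \<subseteq> {1..n} \<and> (\<forall>i\<in>{1..n}. count_list w i = k) \<and>
     (\<forall>p q r. p < q \<and> q < r \<and> r < length w \<and> w ! p = w ! r \<longrightarrow> w ! p \<le> w ! q)}"

text \<open>A word \<open>a\<^sub>1 \<dots> a\<^sub>N\<close> with \<open>a\<^sub>0 = a\<^bsub>N+1\<^esub> = 0\<close>; the list index of an entry is its subscript.\<close>

definition padded :: "nat list \<Rightarrow> nat list" where
  "padded w = 0 # w @ [0]"

definition ascents :: "nat list \<Rightarrow> nat" where
  "ascents w = card {i \<in> {0..length w}. padded w ! i < padded w ! (i + 1)}"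

definition descents :: "nat list \<Rightarrow> nat" where
  "descents w = card {i \<in> {0..length w}. padded w ! i > padded w ! (i + 1)}"


subsection \<open>Plane recursive trees\<close>

datatype plane_tree = Node (root: nat) (children: "plane_tree list")

fun labels :: "plane_tree \<Rightarrow> nat list" where
  "labels (Node a ts) = a # concat (map labels ts)"

fun increasing :: "plane_tree \<Rightarrow> bool" where
  "increasing (Node a ts) \<longleftrightarrow> (\<forall>t\<in>set ts. a < root t \<and> increasing t)"

definition increasing_trees :: "nat \<Rightarrow> plane_tree set" where
  "increasing_trees m =
     {t. root t = 1 \<and> increasing t \<and> distinct (labels t) \<and> set (labels t) = {1..m}}"

fun leaves :: "plane_tree \<Rightarrow> nat" where
  "leaves (Node a ts) = (if ts = [] then 1 else (\<Sum>t\<leftarrow>ts. leaves t))"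

definition phi :: "nat \<Rightarrow> nat \<Rightarrow> real" where
  "phi k d = 1 / fact d * (\<Prod>l = 1..d. ((real k - 1) * (real l - 1) + 1))"

fun weight :: "nat \<Rightarrow> plane_tree \<Rightarrow> real" where
  "weight k (Node a ts) = phi k (length ts) * (\<Prod>t\<leftarrow>ts. weight k t)"

definition total_weight :: "nat \<Rightarrow> nat \<Rightarrow> real" where
  "total_weight k m = (\<Sum>t\<in>increasing_trees m. weight k t)"

text \<open>For \<open>k \<ge> 1\<close> and \<open>m \<ge> 1\<close> this is a genuine probability mass function, see
  \<open>pmf_random_tree\<close> below.\<close>

definition random_tree :: "nat \<Rightarrow> nat \<Rightarrow> plane_tree pmf" where
  "random_tree k m = embed_pmf
     (\<lambda>t. if t \<in> increasing_trees m then weight k t / total_weight k m else 0)"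


subsection \<open>Well-definedness of the random tree\<close>

lemma finite_trees_bounded:
  assumes "finite A"
  shows "finite {t. set (labels t) \<subseteq> A \<and> length (labels t) \<le> m}"
proof (induction m)
  case 0
  have "labels t \<noteq> []" for t
    by (cases t) simp
  then show ?case by simp
next
  case (Suc m)
  let ?S = "{t. set (labels t) \<subseteq> A \<and> length (labels t) \<le> m}"
  have len: "length ts \<le> length (concat (map labels ts))" for ts
  proof (induction ts)
    case (Cons t ts)
    then show ?case by (cases t) auto
  qed simp
  have mem: "length (labels t) \<le> length (concat (map labels ts))" if "t \<in> set ts" for t ts
    using that by (induction ts) auto
  have "{t. set (labels t) \<subseteq> A \<and> length (labels t) \<le> Suc m} \<subseteq>
      case_prod Node ` (A \<times> {ts. set ts \<subseteq> ?S \<and> length ts \<le> m})"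
  proof
    fix t assume t: "t \<in> {t. set (labels t) \<subseteq> A \<and> length (labels t) \<le> Suc m}"
    obtain a ts where [simp]: "t = Node a ts" by (cases t)
    have l: "length (concat (map labels ts)) \<le> m" and s: "set (concat (map labels ts)) \<subseteq> A"
      and "a \<in> A"
      using t by auto
    have "length ts \<le> m" using len[of ts] l by linarith
    moreover have "set ts \<subseteq> ?S"
    proof
      fix u assume u: "u \<in> set ts"
      have "length (labels u) \<le> m" using mem[OF u] l by linarith
      moreover have "set (labels u) \<subseteq> A" using s u by auto
      ultimately show "u \<in> ?S" by simp
    qed
    ultimately show "t \<in> case_prod Node ` (A \<times> {ts. set ts \<subseteq> ?S \<and> length ts \<le> m})"
      using \<open>a \<in> A\<close> by force
  qed
  moreover have "finite (A \<times> {ts. set ts \<subseteq> ?S \<and> length ts \<le> m})"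
    by (intro finite_cartesian_product assms finite_lists_length_le Suc)
  ultimately show ?case by (meson finite_imageI finite_subset)
qed

lemma finite_increasing_trees: "finite (increasing_trees m)"
proof (rule finite_subset)
  show "increasing_trees m \<subseteq> {t. set (labels t) \<subseteq> {1..m} \<and> length (labels t) \<le> m}"
    by (auto simp: increasing_trees_def simp flip: distinct_card)
  show "finite {t. set (labels t) \<subseteq> {1..m} \<and> length (labels t) \<le> m}"
    by (rule finite_trees_bounded) simp
qed

lemma increasing_trees_nonempty:
  assumes "m \<ge> 1"
  shows "increasing_trees m \<noteq> {}"
proof -
  have *: "concat (map (labels \<circ> (\<lambda>i. Node i [])) xs) = xs" for xs
    by (induction xs) auto
  have "Node 1 (map (\<lambda>i. Node i []) [2..<Suc m]) \<in> increasing_trees m"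
    using assms * by (auto simp: increasing_trees_def simp del: upt_Suc)
  then show ?thesis by blast
qed

lemma phi_pos:
  assumes "k \<ge> 1"
  shows "phi k d > 0"
  unfolding phi_def using assms
  by (intro mult_pos_pos prod_pos) (auto intro!: add_nonneg_pos)

lemma weight_pos:
  assumes "k \<ge> 1"
  shows "weight k t > 0"
proof (induction t)
  case (Node a ts)
  have "(\<Prod>t\<leftarrow>us. weight k t) > 0" if "set us \<subseteq> set ts" for us
    using that by (induction us) (auto intro!: mult_pos_pos Node)
  then show ?case using phi_pos[OF assms] by simp
qed

lemma total_weight_pos:
  assumes "k \<ge> 1" "m \<ge> 1"
  shows "total_weight k m > 0"
  unfolding total_weight_def
  by (intro sum_pos finite_increasing_trees increasing_trees_nonempty weight_pos assms)

lemma pmf_random_tree: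
  assumes "k \<ge> 1" "m \<ge> 1"
  shows "pmf (random_tree k m) t =
    (if t \<in> increasing_trees m then weight k t / total_weight k m else 0)"
  unfolding random_tree_def
proof (rule pmf_embed_pmf)
  let ?f = "\<lambda>t. if t \<in> increasing_trees m then weight k t / total_weight k m else 0"
  note T = total_weight_pos[OF assms] and w = weight_pos[OF assms(1)]
  show "0 \<le> ?f t" for t using T w[of t] by simp
  have "(\<integral>\<^sup>+ t. ennreal (?f t) \<partial>count_space UNIV) =
      (\<integral>\<^sup>+ t. ennreal (?f t) \<partial>count_space (increasing_trees m))"
    by (intro nn_integral_count_space_eq) auto
  also have "\<dots> = (\<Sum>t\<in>increasing_trees m. ennreal (?f t))"
    by (rule nn_integral_count_space_finite[OF finite_increasing_trees])
  also have "\<dots> = ennreal (\<Sum>t\<in>increasing_trees m. ?f t)"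
    by (rule sum_ennreal) (use T w in \<open>auto intro: less_imp_le\<close>)
  also have "(\<Sum>t\<in>increasing_trees m. ?f t) = 1"
    using T by (simp add: total_weight_def flip: sum_divide_distrib)
  finally show "(\<integral>\<^sup>+ t. ennreal (?f t) \<partial>count_space UNIV) = 1" by simp
qed

end

theory Submission
  imports Defs "HOL-Library.Sublist"
begin

text \<open>
  Both families grow by inserting the maximal label. A plane tree \<open>t\<close> of order \<open>m\<close> receives
  \<open>m + 1\<close> as a new leaf: a vertex of out-degree \<open>d\<close> offers \<open>d + 1\<close> positions, each of which
  multiplies the weight by \<open>phi k (d + 1) / phi k d\<close>, so the vertex contributes the factor
  \<open>(k - 1) d + 1\<close>. Leaves contribute 1 each and keep the number of leaves unchanged, all other
  insertions increase it by one, and the factors add up to \<open>k (m - 1) + 1\<close>. In a Stirling permutation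
  of order \<open>n\<close> the \<open>k\<close> copies of \<open>n + 1\<close> are inserted as a block into one of \<open>k n + 1\<close>
  gaps; the number of ascents is unchanged at an ascent and grows by one elsewhere, and likewise
  for descents. With \<open>m = n + 1\<close> the two recurrences coincide. They are stated for sums of an
  arbitrary test function \<open>f\<close> of the statistic, which gives total mass and distribution at once.
\<close>

subsection \<open>Inserting the maximal label into a tree\<close>

text \<open>The new leaf \<open>x\<close> is inserted anywhere in a tree (\<open>ins_leaf\<close>), as a new tree of a forest
  (\<open>ins_top\<close>), or inside one of the trees of a forest (\<open>ins_deep\<close>); only \<open>ins_top\<close> changes
  the out-degree of the vertex above the forest.\<close>

fun ins_leaf :: "nat \<Rightarrow> plane_tree \<Rightarrow> plane_tree set"
  and ins_top :: "nat \<Rightarrow> plane_tree list \<Rightarrow> plane_tree list set"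
  and ins_deep :: "nat \<Rightarrow> plane_tree list \<Rightarrow> plane_tree list set"
where
  "ins_leaf x (Node a ts) = Node a ` (ins_top x ts \<union> ins_deep x ts)"
| "ins_top x [] = {[Node x []]}"
| "ins_top x (t # ts) = insert (Node x [] # t # ts) ((#) t ` ins_top x ts)"
| "ins_deep x [] = {}"
| "ins_deep x (t # ts) = (\<lambda>u. u # ts) ` ins_leaf x t \<union> (#) t ` ins_deep x ts"

text \<open>Inverse of insertion. Only the one-vertex tree \<open>Node x []\<close> is dropped: in
  an increasing tree whose maximal label is \<open>x\<close>, that label sits on a leaf.\<close>

fun remove_leaf :: "nat \<Rightarrow> plane_tree \<Rightarrow> plane_tree" where
  "remove_leaf x (Node a ts) = Node a (map (remove_leaf x) (filter (\<lambda>t. t \<noteq> Node x []) ts))"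

abbreviation forest_labels :: "plane_tree list \<Rightarrow> nat list" where
  "forest_labels ts \<equiv> concat (map labels ts)"

abbreviation forest_weight :: "nat \<Rightarrow> plane_tree list \<Rightarrow> real" where
  "forest_weight k ts \<equiv> (\<Prod>t\<leftarrow>ts. weight k t)"

abbreviation forest_leaves :: "plane_tree list \<Rightarrow> nat" where
  "forest_leaves ts \<equiv> (\<Sum>t\<leftarrow>ts. leaves t)"

section \<open>Labels, roots and monotonicity after an insertion\<close>

lemma root_in_labels: "root t \<in> set (labels t)"
  by (cases t) auto

lemma finite_ins: "finite (ins_leaf x t)" "finite (ins_top x ts)" "finite (ins_deep x ts)"
  by (induction x t and x ts and x ts rule: ins_leaf_ins_top_ins_deep.induct) auto

lemma length_ins_top: "us \<in> ins_top x ts \<Longrightarrow> length us = Suc (length ts)"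
  by (induction ts arbitrary: us) auto

lemma length_ins_deep: "us \<in> ins_deep x ts \<Longrightarrow> length us = length ts"
  by (induction ts arbitrary: us) auto

text \<open>Multisets forget where the new label lands in preorder, yet still determine both
  distinctness and the label set.\<close>

lemma mset_labels_ins:
  "\<forall>u \<in> ins_leaf x t. mset (labels u) = add_mset x (mset (labels t))"
  "\<forall>us \<in> ins_top x ts. mset (forest_labels us) = add_mset x (mset (forest_labels ts))"
  "\<forall>us \<in> ins_deep x ts. mset (forest_labels us) = add_mset x (mset (forest_labels ts))"
  by (induction x t and x ts and x ts rule: ins_leaf_ins_top_ins_deep.induct) auto

lemma x_in_labels_ins_leaf: "u \<in> ins_leaf x t \<Longrightarrow> x \<in> set (labels u)"
  using mset_labels_ins(1) by (metis set_mset_mset set_mset_add_mset_insert insertI1)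

lemma root_ins_leaf: "u \<in> ins_leaf x t \<Longrightarrow> root u = root t"
  by (cases t) auto

text \<open>A fresh maximum may hang below any vertex. In the forest clauses \<open>a\<close> plays
  the label of the vertex above the forest.\<close>

lemma increasing_ins:
  "increasing t \<Longrightarrow> \<forall>y\<in>set (labels t). y < x \<Longrightarrow> u \<in> ins_leaf x t \<Longrightarrow> increasing u"
  "\<forall>t\<in>set ts. increasing t \<and> a < root t \<Longrightarrow> a < x \<Longrightarrow> us \<in> ins_top x ts \<Longrightarrow>
     \<forall>u\<in>set us. increasing u \<and> a < root u"
  "\<forall>t\<in>set ts. increasing t \<and> a < root t \<Longrightarrow> \<forall>y\<in>set (forest_labels ts). y < x \<Longrightarrow>
     us \<in> ins_deep x ts \<Longrightarrow> \<forall>u\<in>set us. increasing u \<and> a < root u"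
proof (induction x t and x ts and x ts arbitrary: u and a us and a us
    rule: ins_leaf_ins_top_ins_deep.induct)
  case (1 x b ts)
  from 1(5) obtain us where us: "u = Node b us" "us \<in> ins_top x ts \<or> us \<in> ins_deep x ts"
    by auto
  have "\<forall>v\<in>set us. increasing v \<and> b < root v"
    using us(2)
  proof
    assume "us \<in> ins_top x ts"
    with 1(3,4) show ?thesis by - (rule 1(1), auto)
  next
    assume "us \<in> ins_deep x ts"
    with 1(3,4) show ?thesis by - (rule 1(2), auto)
  qed
  with us show ?case by simp
next
  case (3 x t ts)
  from 3(4) consider "us = Node x [] # t # ts" | vs where "us = t # vs" "vs \<in> ins_top x ts"
    by auto
  then show ?case
  proof cases
    case (2 vs)
    have "\<forall>u\<in>set vs. increasing u \<and> a < root u"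
      using 3(2,3) 2 by - (rule 3(1), auto)
    with 2 3 show ?thesis by simp
  qed (use 3 in simp)
next
  case (5 x t ts)
  from 5(5) consider v where "us = v # ts" "v \<in> ins_leaf x t"
    | vs where "us = t # vs" "vs \<in> ins_deep x ts"
    by auto
  then show ?case
  proof cases
    case (1 v)
    have "increasing v" using 5(3,4) 1 by - (rule 5(1), auto)
    with 1 5(3) show ?thesis by (simp add: root_ins_leaf)
  next
    case (2 vs)
    have "\<forall>u\<in>set vs. increasing u \<and> a < root u"
      using 5(3,4) 2 by - (rule 5(2), auto)
    with 2 5(3) show ?thesis by simp
  qed
qed simp_all

section \<open>Removing the maximal label as the inverse of insertion\<close>

lemma remove_leaf_absent: "x \<notin> set (labels t) \<Longrightarrow> remove_leaf x t = t"
proof (induction x t rule: remove_leaf.induct)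
  case (1 x a ts)
  have "filter (\<lambda>t. t \<noteq> Node x []) ts = ts"
    using 1(2) by (auto simp: filter_id_conv)
  then show ?case using 1 by (auto intro!: map_idI)
qed

lemma remove_forest_absent:
  assumes "x \<notin> set (forest_labels ts)"
  shows "map (remove_leaf x) (filter (\<lambda>t. t \<noteq> Node x []) ts) = ts"
proof -
  have "filter (\<lambda>t. t \<noteq> Node x []) ts = ts"
    using assms by (auto simp: filter_id_conv)
  then show ?thesis using assms by (auto intro!: map_idI remove_leaf_absent)
qed

text \<open>The original tree can be read off the enlarged one, so insertion sets of different trees
  are disjoint.\<close>

lemma remove_leaf_ins:
  "x \<notin> set (labels t) \<Longrightarrow> u \<in> ins_leaf x t \<Longrightarrow> remove_leaf x u = t"
  "x \<notin> set (forest_labels ts) \<Longrightarrow> us \<in> ins_top x ts \<Longrightarrow>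
     map (remove_leaf x) (filter (\<lambda>t. t \<noteq> Node x []) us) = ts"
  "x \<notin> set (forest_labels ts) \<Longrightarrow> us \<in> ins_deep x ts \<Longrightarrow>
     map (remove_leaf x) (filter (\<lambda>t. t \<noteq> Node x []) us) = ts"
proof (induction x t and x ts and x ts arbitrary: u and us and us
    rule: ins_leaf_ins_top_ins_deep.induct)
  case (1 x a ts)
  then show ?case by auto
next
  case (3 x t ts)
  have t: "t \<noteq> Node x []" "remove_leaf x t = t" using 3 by (auto simp: remove_leaf_absent)
  from 3(3) consider "us = Node x [] # t # ts" | vs where "us = t # vs" "vs \<in> ins_top x ts"
    by auto
  then show ?case
  proof cases
    case 1
    have "map (remove_leaf x) (filter (\<lambda>t. t \<noteq> Node x []) ts) = ts"
      using 3(2) by (intro remove_forest_absent) auto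
    then show ?thesis using 1 t by simp
  next
    case (2 vs)
    have "map (remove_leaf x) (filter (\<lambda>t. t \<noteq> Node x []) vs) = ts"
      using 3(2) 2 by - (rule 3(1), auto)
    then show ?thesis using 2 t by simp
  qed
next
  case (5 x t ts)
  from 5(4) consider v where "us = v # ts" "v \<in> ins_leaf x t"
    | vs where "us = t # vs" "vs \<in> ins_deep x ts"
    by auto
  then show ?case
  proof cases
    case (1 v)
    \<comment> \<open>Insertion keeps the root, and the root of \<open>t\<close> is not
      \<open>x\<close>; the filter therefore retains \<open>v\<close>.\<close>
    have "v \<noteq> Node x []"
      using root_ins_leaf[OF 1(2)] root_in_labels[of t] 5(3) by auto
    moreover have "remove_leaf x v = t"
      using 5(3) 1 by - (rule 5(1), auto)
    moreover have "map (remove_leaf x) (filter (\<lambda>t. t \<noteq> Node x []) ts) = ts"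
      using 5(3) by (intro remove_forest_absent) auto
    ultimately show ?thesis using 1 by simp
  next
    case (2 vs)
    have "t \<noteq> Node x []" "remove_leaf x t = t" using 5(3) by (auto simp: remove_leaf_absent)
    moreover have "map (remove_leaf x) (filter (\<lambda>t. t \<noteq> Node x []) vs) = ts"
      using 5(3) 2 by - (rule 5(2), auto)
    ultimately show ?thesis using 2 by simp
  qed
qed simp_all

lemma root_remove_leaf: "root (remove_leaf x t) = root t"
  by (cases t) auto

text \<open>A child of a vertex labelled \<open>x\<close> would carry a label above the
  maximum.\<close>

lemma maximal_label_leaf:
  assumes "increasing t" "\<forall>y\<in>set (labels t). y \<le> x"
  shows "t = Node x [] \<or> root t \<noteq> x"
proof (cases t)
  case [simp]: (Node b us)
  have "x < root u \<and> root u \<le> x" if "b = x" "u \<in> set us" for u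
    using assms that root_in_labels[of u] by fastforce
  then show ?thesis by (cases us) force+
qed

text \<open>Every child is either the leaf to be dropped or has a root other than \<open>x\<close>,
  so the recursion always stays within the hypotheses.\<close>

lemma labels_remove_leaf:
  assumes "increasing t" "\<forall>y\<in>set (labels t). y \<le> x" "root t \<noteq> x"
  shows "labels (remove_leaf x t) = filter (\<lambda>y. y \<noteq> x) (labels t) \<and> increasing (remove_leaf x t)"
  using assms
proof (induction t)
  case (Node a ts)
  have *: "t = Node x [] \<or> root t \<noteq> x" if "t \<in> set ts" for t
    using Node.prems that by (intro maximal_label_leaf) auto
  have IH: "labels (remove_leaf x t) = filter (\<lambda>y. y \<noteq> x) (labels t) \<and> increasing (remove_leaf x t)"
    if "t \<in> set ts" "t \<noteq> Node x []" for t
    using Node.IH[OF that(1)] Node.prems *[OF that(1)] that by auto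
  \<comment> \<open>Stated for all \<open>us\<close> with members from \<open>ts\<close>, so that
    list induction can run while \<open>IH\<close> stays tied to the children.\<close>
  have "forest_labels (map (remove_leaf x) (filter (\<lambda>t. t \<noteq> Node x []) us)) =
      filter (\<lambda>y. y \<noteq> x) (forest_labels us)" if "set us \<subseteq> set ts" for us
    using that by (induction us) (auto simp: IH)
  then show ?case using Node.prems IH by (auto simp: root_remove_leaf)
qed

text \<open>Surjectivity of insertion. Distinctness puts \<open>x\<close> into exactly one child, so
  removal changes only that child and one insertion restores it.\<close>

lemma mem_ins_leaf_remove_leaf:
  assumes "increasing t" "distinct (labels t)" "\<forall>y\<in>set (labels t). y \<le> x" "root t \<noteq> x"
    "x \<in> set (labels t)"
  shows "t \<in> ins_leaf x (remove_leaf x t)"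
  using assms
proof (induction t)
  case (Node a ts)
  have *: "t = Node x [] \<or> root t \<noteq> x" if "t \<in> set ts" for t
    using Node.prems that by (intro maximal_label_leaf) auto
  have IH: "t \<in> ins_leaf x (remove_leaf x t)"
    if "t \<in> set ts" "t \<noteq> Node x []" "x \<in> set (labels t)" for t
    using Node.IH[OF that(1)] Node.prems *[OF that(1)] that
    by (auto simp: distinct_concat_iff distinct_map)
  \<comment> \<open>If the tree containing \<open>x\<close> is the bare leaf, it comes from
    \<open>ins_top\<close>; otherwise the insertion took place inside it and \<open>ins_deep\<close>
    applies.\<close>
  have "us \<in> (let vs = map (remove_leaf x) (filter (\<lambda>t. t \<noteq> Node x []) us)
      in ins_top x vs \<union> ins_deep x vs)"
    if "set us \<subseteq> set ts" "distinct (forest_labels us)" "x \<in> set (forest_labels us)" for us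
    using that
  proof (induction us)
    case (Cons u us)
    show ?case
    proof (cases "x \<in> set (labels u)")
      case True
      then have "x \<notin> set (forest_labels us)" using Cons.prems by auto
      note ab = remove_forest_absent[OF this]
      show ?thesis
      proof (cases "u = Node x []")
        case True
        then show ?thesis by (cases us) (use ab in \<open>auto simp: Let_def\<close>)
      next
        case False
        then show ?thesis using IH[of u] True Cons.prems ab by (auto simp: Let_def)
      qed
    next
      case False
      moreover from this have "u \<noteq> Node x []" by auto
      ultimately show ?thesis using Cons by (auto simp: Let_def remove_leaf_absent)
    qed
  qed simp
  from this[of ts] show ?case using Node.prems by (auto simp: Let_def)
qed

text \<open>Since \<open>m \<ge> 1\<close>, the label \<open>Suc m\<close> differs from the root
  label 1, so insertion and removal never concern the root.\<close>

lemma increasing_trees_Suc: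
  assumes "m \<ge> 1"
  shows "increasing_trees (Suc m) = (\<Union>t\<in>increasing_trees m. ins_leaf (Suc m) t)"
proof (intro equalityI subsetI)
  fix u assume "u \<in> increasing_trees (Suc m)"
  then have u: "root u = 1" "increasing u" "distinct (labels u)" "set (labels u) = {1..Suc m}"
    by (auto simp: increasing_trees_def)
  let ?t = "remove_leaf (Suc m) u"
  have l: "labels ?t = filter (\<lambda>y. y \<noteq> Suc m) (labels u) \<and> increasing ?t"
    using u assms by (intro labels_remove_leaf) auto
  have "?t \<in> increasing_trees m"
    using u l by (auto simp: increasing_trees_def root_remove_leaf)
  moreover have "u \<in> ins_leaf (Suc m) ?t"
    using u assms by (intro mem_ins_leaf_remove_leaf) auto
  ultimately show "u \<in> (\<Union>t\<in>increasing_trees m. ins_leaf (Suc m) t)" by blast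
next
  fix u assume "u \<in> (\<Union>t\<in>increasing_trees m. ins_leaf (Suc m) t)"
  then obtain t where t: "root t = 1" "increasing t" "distinct (labels t)" "set (labels t) = {1..m}"
    and u: "u \<in> ins_leaf (Suc m) t"
    by (auto simp: increasing_trees_def)
  have m: "mset (labels u) = mset (Suc m # labels t)"
    using mset_labels_ins(1) u by auto
  have "distinct (labels u)" using mset_eq_imp_distinct_iff[OF m] t by auto
  moreover have "set (labels u) = {1..Suc m}"
    using mset_eq_setD[OF m] t by auto
  moreover have "increasing u" using t u by (intro increasing_ins(1)[of t "Suc m" u]) auto
  ultimately show "u \<in> increasing_trees (Suc m)"
    using root_ins_leaf[OF u] t by (auto simp: increasing_trees_def)
qed

section \<open>Weights and leaf numbers under insertion\<close>

text \<open>The \<open>Suc d\<close> insertion positions cancel against the factorial; what remains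
  is the product factor with \<open>l = d + 1\<close>.\<close>

lemma phi_Suc:
  "real (Suc d) * phi k (Suc d) = phi k d * ((real k - 1) * real d + 1)"
proof -
  have "real (Suc d) * (1 / (real (Suc d) * F) * (P * c)) = 1 / F * P * c" if "F > 0" for F P c :: real
    using that by (simp add: field_simps del: of_nat_Suc)
  from this[OF fact_gt_zero] show ?thesis
    by (simp add: phi_def del: of_nat_Suc)
qed

lemma ins_top_card:
  "x \<notin> set (forest_labels ts) \<Longrightarrow> card (ins_top x ts) = Suc (length ts)"
proof (induction ts)
  case (Cons t ts)
  have "t \<noteq> Node x []" using Cons by auto
  then have "Node x [] # t # ts \<notin> (#) t ` ins_top x ts" by auto
  then show ?case using Cons by (simp add: finite_ins card_image)
qed simp

text \<open>The new tree is a single leaf, of weight \<open>phi k 0 = 1\<close>.\<close>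

lemma ins_top_stat:
  "us \<in> ins_top x ts \<Longrightarrow>
    forest_weight k us = forest_weight k ts \<and> forest_leaves us = Suc (forest_leaves ts)"
  by (induction ts arbitrary: us) (auto simp: phi_def)

text \<open>For \<open>m\<close> vertices in \<open>r\<close> trees the out-degrees add up to
  \<open>m - r\<close>, so the factors \<open>(k - 1) d + 1\<close> add up to
  \<open>k m - (k - 1) r\<close>; each leaf accounts for 1 of this. The clause \<open>True\<close>
  fills the \<open>ins_top\<close> slot of the mutual induction: those insertions change the factor
  of the parent and are treated in the tree case.\<close>

lemma sum_ins:
  shows "x \<notin> set (labels t) \<Longrightarrow>
    (\<Sum>u\<in>ins_leaf x t. weight k u * f (leaves u)) =
    weight k t * (real (leaves t) * f (leaves t) +
      (real k * real (length (labels t)) - (real k - 1) - real (leaves t)) * f (Suc (leaves t)))"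
  and "True"
  and "x \<notin> set (forest_labels ts) \<Longrightarrow>
    (\<Sum>us\<in>ins_deep x ts. forest_weight k us * f (forest_leaves us)) =
    forest_weight k ts * (real (forest_leaves ts) * f (forest_leaves ts) +
      (real k * real (length (forest_labels ts)) - (real k - 1) * real (length ts)
        - real (forest_leaves ts)) * f (Suc (forest_leaves ts)))"
proof (induction x t and x ts and x ts arbitrary: f and and f rule: ins_leaf_ins_top_ins_deep.induct)
  case (1 x a ts)
  have disj: "ins_top x ts \<inter> ins_deep x ts = {}"
    using length_ins_top length_ins_deep by fastforce
  have x: "x \<notin> set (forest_labels ts)" using 1 by auto
  have inj: "inj_on (Node a) A" for A by (auto simp: inj_on_def)
  let ?g = "\<lambda>u. weight k u * f (leaves u)"
  have "(\<Sum>u\<in>ins_leaf x (Node a ts). ?g u) =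
      (\<Sum>us\<in>ins_top x ts. ?g (Node a us)) + (\<Sum>us\<in>ins_deep x ts. ?g (Node a us))"
    by (simp add: sum.reindex[OF inj] sum.union_disjoint finite_ins disj
        del: weight.simps leaves.simps)
  also have "(\<Sum>us\<in>ins_top x ts. ?g (Node a us)) =
      (\<Sum>us\<in>ins_top x ts. phi k (Suc (length ts)) * forest_weight k ts * f (Suc (forest_leaves ts)))"
  proof (intro sum.cong refl)
    fix us assume us: "us \<in> ins_top x ts"
    \<comment> \<open>Only for a nonempty list of children is \<open>leaves (Node a us)\<close> the
      sum over \<open>us\<close>.\<close>
    have "us \<noteq> []" using length_ins_top[OF us] by auto
    then show "?g (Node a us) =
        phi k (Suc (length ts)) * forest_weight k ts * f (Suc (forest_leaves ts))"
      using length_ins_top[OF us] ins_top_stat[OF us, of k] by simp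
  qed
  also have "\<dots> = real (Suc (length ts)) * phi k (Suc (length ts)) *
      (forest_weight k ts * f (Suc (forest_leaves ts)))"
    by (simp add: ins_top_card[OF x])
  also have "\<dots> = phi k (length ts) * ((real k - 1) * real (length ts) + 1) *
      (forest_weight k ts * f (Suc (forest_leaves ts)))"
    by (simp only: phi_Suc)
  also have "(\<Sum>us\<in>ins_deep x ts. ?g (Node a us)) =
      (\<Sum>us\<in>ins_deep x ts. phi k (length ts) * (forest_weight k us * f (forest_leaves us)))"
  proof (intro sum.cong refl)
    fix us assume us: "us \<in> ins_deep x ts"
    then have "ts \<noteq> []" by auto
    then have "us \<noteq> []" using length_ins_deep[OF us] by auto
    then show "?g (Node a us) = phi k (length ts) * (forest_weight k us * f (forest_leaves us))"
      using length_ins_deep[OF us] by simp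
  qed
  also have "\<dots> = phi k (length ts) *
      (\<Sum>us\<in>ins_deep x ts. forest_weight k us * f (forest_leaves us))"
    by (simp add: sum_distrib_left)
  \<comment> \<open>For \<open>ts = []\<close> the vertex is itself a leaf:
    \<open>Suc (forest_leaves ts)\<close> is then 1, the unchanged number of leaves.\<close>
  finally show ?case
    unfolding 1(2)[OF x] by (cases "ts = []") (auto simp: algebra_simps)
next
  case (5 x t ts)
  have x: "x \<notin> set (labels t)" "x \<notin> set (forest_labels ts)" using 5 by auto
  \<comment> \<open>The head tree contains \<open>x\<close> in the first set and not in the
    second.\<close>
  have disj: "(\<lambda>u. u # ts) ` ins_leaf x t \<inter> (#) t ` ins_deep x ts = {}"
    using x x_in_labels_ins_leaf by auto
  have inj: "inj_on (\<lambda>u. u # ts) A" "inj_on ((#) t) B" for A B by (auto simp: inj_on_def)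
  let ?g = "\<lambda>us. forest_weight k us * f (forest_leaves us)"
  have "(\<Sum>us\<in>ins_deep x (t # ts). ?g us) =
      (\<Sum>u\<in>ins_leaf x t. ?g (u # ts)) + (\<Sum>us\<in>ins_deep x ts. ?g (t # us))"
    by (simp only: ins_deep.simps sum.union_disjoint finite_imageI finite_ins disj
        sum.reindex[OF inj(1)] sum.reindex[OF inj(2)] comp_def)
  also have "(\<Sum>u\<in>ins_leaf x t. ?g (u # ts)) =
      forest_weight k ts * (\<Sum>u\<in>ins_leaf x t. weight k u * f (leaves u + forest_leaves ts))"
    by (simp add: sum_distrib_left mult_ac)
  also have "(\<Sum>us\<in>ins_deep x ts. ?g (t # us)) =
      weight k t * (\<Sum>us\<in>ins_deep x ts. forest_weight k us * f (leaves t + forest_leaves us))"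
    by (simp add: sum_distrib_left mult_ac)
  \<comment> \<open>Leaves outside the altered part only shift the argument of \<open>f\<close>, so
    the hypotheses are used for shifted test functions.\<close>
  finally show ?case
    unfolding 5(1)[OF x(1), of "\<lambda>j. f (j + forest_leaves ts)"]
      5(2)[OF x(2), of "\<lambda>j. f (leaves t + j)"]
    by (simp add: algebra_simps)
qed auto

lemma length_labels_increasing_trees: "t \<in> increasing_trees m \<Longrightarrow> length (labels t) = m"
  by (auto simp: increasing_trees_def simp flip: distinct_card)

lemma sum_increasing_trees_Suc:
  assumes "m \<ge> 1"
  shows "(\<Sum>t\<in>increasing_trees (Suc m). weight k t * f (leaves t)) =
    (\<Sum>t\<in>increasing_trees m. weight k t * (real (leaves t) * f (leaves t) +
      (real k * real m - (real k - 1) - real (leaves t)) * f (Suc (leaves t))))"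
proof -
  have x: "Suc m \<notin> set (labels t)" if "t \<in> increasing_trees m" for t
    using that by (auto simp: increasing_trees_def)
  have "(\<Sum>t\<in>increasing_trees (Suc m). weight k t * f (leaves t)) =
      (\<Sum>t\<in>increasing_trees m. \<Sum>u\<in>ins_leaf (Suc m) t. weight k u * f (leaves u))"
    unfolding increasing_trees_Suc[OF assms]
  proof (intro sum.UNION_disjoint finite_increasing_trees ballI finite_ins impI)
    fix t t' assume tt: "t \<in> increasing_trees m" "t' \<in> increasing_trees m" "t \<noteq> t'"
    then show "ins_leaf (Suc m) t \<inter> ins_leaf (Suc m) t' = {}"
      using remove_leaf_ins(1)[OF x[OF tt(1)]] remove_leaf_ins(1)[OF x[OF tt(2)]] by blast
  qed
  also have "\<dots> = (\<Sum>t\<in>increasing_trees m. weight k t * (real (leaves t) * f (leaves t) +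
      (real k * real m - (real k - 1) - real (leaves t)) * f (Suc (leaves t))))"
    by (intro sum.cong refl) (simp add: sum_ins(1)[OF x] length_labels_increasing_trees)
  finally show ?thesis .
qed

lemma increasing_trees_1: "increasing_trees 1 = {Node 1 []}"
proof -
  have "t = Node 1 []" if "root t = 1" "increasing t" "set (labels t) = {1..1}" for t
  proof (cases t)
    case [simp]: (Node a ts)
    \<comment> \<open>Contradictory on purpose: a child would exceed the root label 1 and also lie
      in \<open>{1..1}\<close>, so there are no children.\<close>
    have "root u \<noteq> 1 \<and> root u = 1" if "u \<in> set ts" for u
      using \<open>increasing t\<close> \<open>set (labels t) = _\<close> \<open>root t = 1\<close> root_in_labels[of u] that by fastforce
    then show ?thesis using \<open>root t = 1\<close> by (cases ts) force+
  qed
  then show ?thesis by (auto simp: increasing_trees_def)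
qed

subsection \<open>Inserting the maximal letter into a Stirling permutation\<close>

lemma set_subset_of_subseq: "subseq xs ys \<Longrightarrow> set xs \<subseteq> set ys"
  by (auto dest: list_emb_set)

text \<open>Replaces index triples by subsequences, which pass easily through filtering and
  concatenation.\<close>

lemma subseq3_iff_nth:
  "subseq [a, b, c] w \<longleftrightarrow>
    (\<exists>p q r. p < q \<and> q < r \<and> r < length w \<and> w ! p = a \<and> w ! q = b \<and> w ! r = c)"
proof
  assume "subseq [a, b, c] w"
  then obtain xs us zs zs' where w: "w = xs @ a # us @ b # zs @ c # zs'"
    by (auto dest!: list_emb_ConsD)
  show "\<exists>p q r. p < q \<and> q < r \<and> r < length w \<and> w ! p = a \<and> w ! q = b \<and> w ! r = c"
    by (rule exI[of _ "length xs"], rule exI[of _ "length (xs @ a # us)"],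
        rule exI[of _ "length (xs @ a # us @ b # zs)"]) (simp add: w nth_append)
next
  assume "\<exists>p q r. p < q \<and> q < r \<and> r < length w \<and> w ! p = a \<and> w ! q = b \<and> w ! r = c"
  then obtain p q r where *: "p < q" "q < r" "r < length w" "w ! p = a" "w ! q = b" "w ! r = c"
    by blast
  \<comment> \<open>The word is cut at the middle position, leaving \<open>a\<close> strictly before
    it and \<open>c\<close> strictly after it.\<close>
  have 1: "w = take q w @ b # drop (Suc q) w"
    using * id_take_nth_drop[of q w] by simp
  have "a \<in> set (take q w)" using * by (auto simp: in_set_conv_nth intro!: exI[of _ p])
  moreover have "c \<in> set (drop (Suc q) w)"
    using * by (auto simp: in_set_conv_nth intro!: exI[of _ "r - Suc q"])
  ultimately have "subseq ([a] @ b # [c]) (take q w @ b # drop (Suc q) w)"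
    by (intro list_emb_append_mono list_emb_Cons2) (auto simp: subseq_singleton_left)
  with 1 show "subseq [a, b, c] w" by simp
qed

lemma stirling_perms_subseq:
  "stirling_perms k n = {w. set w \<subseteq> {1..n} \<and> (\<forall>i\<in>{1..n}. count_list w i = k) \<and>
     (\<forall>a b. subseq [a, b, a] w \<longrightarrow> a \<le> b)}"
  unfolding stirling_perms_def subseq3_iff_nth
  by (intro Collect_cong conj_cong refl) metis

lemma length_stirling_perms:
  assumes "w \<in> stirling_perms k n"
  shows "length w = k * n"
proof -
  have "length w = sum (count_list w) {1..n}"
    using assms by (intro sum_count_set[symmetric]) (auto simp: stirling_perms_def)
  also have "\<dots> = k * n" using assms by (simp add: stirling_perms_def)
  finally show ?thesis .
qed

lemma finite_stirling_perms: "finite (stirling_perms k n)"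
proof (rule finite_subset)
  show "stirling_perms k n \<subseteq> {w. set w \<subseteq> {1..n} \<and> length w = k * n}"
    using length_stirling_perms by (auto simp: stirling_perms_def)
qed (simp add: finite_lists_length_eq)

lemma stirling_perms_0: "stirling_perms k 0 = {[]}"
  by (auto simp: stirling_perms_def)

section \<open>Inserting and deleting the block of maximal letters\<close>

definition insert_block :: "nat \<Rightarrow> nat \<Rightarrow> nat list \<Rightarrow> nat \<Rightarrow> nat list" where
  "insert_block k N w i = take i w @ replicate k N @ drop i w"

lemma filter_insert_block:
  assumes "N \<notin> set w"
  shows "filter (\<lambda>y. y \<noteq> N) (insert_block k N w i) = w"
proof -
  have "filter (\<lambda>y. y \<noteq> N) (take i w) = take i w" "filter (\<lambda>y. y \<noteq> N) (drop i w) = drop i w"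
    using assms by (auto simp: filter_id_conv dest: in_set_takeD in_set_dropD)
  then show ?thesis by (simp add: insert_block_def)
qed

lemma set_insert_block: "set (insert_block k N w i) = set w \<union> (if k = 0 then {} else {N})"
proof -
  have "set (take i w) \<union> set (drop i w) = set w"
    by (metis append_take_drop_id set_append)
  then show ?thesis by (auto simp: insert_block_def)
qed

lemma count_list_replicate: "count_list (replicate k x) y = (if x = y then k else 0)"
  by (induction k) auto

lemma count_list_insert_block:
  "count_list (insert_block k N w i) y = count_list w y + (if N = y then k else 0)"
proof -
  have "count_list w y = count_list (take i w) y + count_list (drop i w) y"
    by (metis append_take_drop_id count_list_append)
  then show ?thesis by (simp add: insert_block_def count_list_replicate)
qed

text \<open>The gap is recovered as the length of the prefix before the first \<open>N\<close>,
  which exists because \<open>k > 0\<close>.\<close>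

lemma insert_block_inj:
  assumes "N \<notin> set w" "k > 0"
  shows "inj_on (insert_block k N w) {..length w}"
proof (rule inj_on_inverseI)
  fix i assume i: "i \<in> {..length w}"
  have "takeWhile (\<lambda>y. y \<noteq> N) (take i w @ replicate k N @ drop i w) =
      take i w @ takeWhile (\<lambda>y. y \<noteq> N) (replicate k N @ drop i w)"
    using assms by (intro takeWhile_append2) (auto dest: in_set_takeD)
  also have "takeWhile (\<lambda>y. y \<noteq> N) (replicate k N @ drop i w) = []"
    using assms by (cases k) auto
  finally show "length (takeWhile (\<lambda>y. y \<noteq> N) (insert_block k N w i)) = i"
    using i by (simp add: insert_block_def)
qed

text \<open>A pattern \<open>[a, b, a]\<close> with \<open>a = N\<close> lies inside the block; one
  with \<open>b = N\<close> is harmless; any other survives the deletion of \<open>N\<close> and so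
  occurs in \<open>w\<close>.\<close>

lemma subseq_insert_block:
  assumes "\<forall>y\<in>set w. y < N" "\<forall>a b. subseq [a, b, a] w \<longrightarrow> a \<le> b"
    and s: "subseq [a, b, a] (insert_block k N w i)"
  shows "a \<le> b"
proof -
  have N: "N \<notin> set w" using assms(1) by auto
  have le: "y \<le> N" if "y \<in> set (insert_block k N w i)" for y
    using assms(1) that by (force simp: set_insert_block split: if_splits)
  have "a \<in> set (insert_block k N w i)"
    using set_subset_of_subseq[OF s] by auto
  then have aN: "a \<le> N" by (rule le)
  show ?thesis
  proof (cases "a = N")
    case True
    have not: "\<not> subseq (N # xs) (take i w)" "\<not> subseq (xs @ [N]) (drop i w)" for xs
      using N by (auto dest!: set_subset_of_subseq dest: in_set_takeD in_set_dropD)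
    from s True have "subseq [N, b, N] (take i w @ replicate k N @ drop i w)"
      by (simp add: insert_block_def)
    then obtain us vs where 1: "[N, b, N] = us @ vs" "subseq us (take i w)"
      "subseq vs (replicate k N @ drop i w)"
      by (rule subseq_appendE)
    \<comment> \<open>A nonempty first piece would begin with \<open>N\<close>, which
      \<open>take i w\<close> lacks. Likewise, below, a nonempty last piece would end in
      \<open>N\<close>, which \<open>drop i w\<close> lacks.\<close>
    have "us = []" using 1 not by (cases us) auto
    with 1 have "subseq [N, b, N] (replicate k N @ drop i w)" by simp
    then obtain us' vs' where 2: "[N, b, N] = us' @ vs'" "subseq us' (replicate k N)"
      "subseq vs' (drop i w)"
      by (rule subseq_appendE)
    have "vs' = []"
    proof (cases vs' rule: rev_cases)
      case (snoc xs y)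
      with 2(1) have "y = N"
        by (metis append_assoc last_snoc last.simps list.simps(3))
      with snoc 2(3) not show ?thesis by simp
    qed
    with 2 have "subseq [N, b, N] (replicate k N)" by simp
    then have "b = N" by (auto dest!: set_subset_of_subseq split: if_splits)
    with True show ?thesis by simp
  next
    case False
    show ?thesis
    proof (cases "b = N")
      case False
      have "subseq (filter (\<lambda>y. y \<noteq> N) [a, b, a]) (filter (\<lambda>y. y \<noteq> N) (insert_block k N w i))"
        using s by (rule subseq_filter)
      then have "subseq [a, b, a] w"
        using \<open>a \<noteq> N\<close> False by (simp add: filter_insert_block[OF N])
      then show ?thesis using assms(2) by blast
    qed (use aN in simp)
  qed
qed

text \<open>A smaller letter \<open>b\<close> between two copies of \<open>N\<close> would form the
  pattern \<open>[N, b, N]\<close> and force \<open>N \<le> b\<close>.\<close>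

lemma maximal_letter_contiguous:
  fixes w :: "'a::order list"
  assumes "\<forall>y\<in>set w. y \<le> N" "\<forall>a b. subseq [a, b, a] w \<longrightarrow> a \<le> b"
  obtains us j vs where "w = us @ replicate j N @ vs" "N \<notin> set us" "N \<notin> set vs"
proof (cases "N \<in> set w")
  case True
  then obtain us rest where w: "w = us @ N # rest" and us: "N \<notin> set us"
    by (meson split_list_first)
  define vs where "vs = dropWhile (\<lambda>y. y = N) rest"
  define ns where "ns = takeWhile (\<lambda>y. y = N) rest"
  have "replicate (length ns) N = ns"
    by (rule replicate_length_same) (auto simp: ns_def dest: set_takeWhileD)
  then have rest: "rest = replicate (length ns) N @ vs"
    by (simp add: ns_def vs_def)
  have "N \<notin> set vs"
  proof
    assume N: "N \<in> set vs"
    then have "vs \<noteq> []" by auto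
    then obtain b vs' where v: "vs = b # vs'" by (cases vs) auto
    have b: "b \<noteq> N"
      using hd_dropWhile[of "\<lambda>y. y = N" rest] v unfolding vs_def by simp
    \<comment> \<open>The leading \<open>N\<close> is its first occurrence in \<open>w\<close>,
      \<open>b\<close> is the letter ending the run of copies, and the last \<open>N\<close> comes
      from \<open>vs\<close>.\<close>
    have "subseq [N, b, N] (N # vs)"
      using N v b by (auto simp: subseq_singleton_left)
    moreover have "subseq (N # vs) w"
      using list_emb_append_mono[of "(=)" "[]" us "N # vs" "N # replicate (length ns) N @ vs"]
      by (simp add: w rest list_emb_append2)
    ultimately have "subseq [N, b, N] w" by (rule subseq_order.trans)
    then have "N \<le> b" using assms(2) by blast
    moreover have "b \<le> N" using assms(1) by (simp add: v w rest)
    ultimately show False using b by simp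
  qed
  moreover have "w = us @ replicate (Suc (length ns)) N @ vs"
    by (simp add: w rest)
  ultimately show ?thesis using us that by blast
next
  case False
  then show ?thesis using that[of w 0 "[]"] by simp
qed

text \<open>The copies of \<open>Suc n\<close> form a run, of length \<open>k\<close> by the letter
  count; deleting it passes to a subsequence, which inherits the Stirling condition.\<close>

lemma stirling_perms_Suc:
  "stirling_perms k (Suc n) =
    (\<Union>w\<in>stirling_perms k n. insert_block k (Suc n) w ` {..length w})"
proof (intro equalityI subsetI)
  fix w assume "w \<in> stirling_perms k (Suc n)"
  then have w: "set w \<subseteq> {1..Suc n}" "\<And>i. i \<in> {1..Suc n} \<Longrightarrow> count_list w i = k"
      "\<forall>a b. subseq [a, b, a] w \<longrightarrow> a \<le> b"
    by (auto simp: stirling_perms_subseq)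
  obtain us j vs where d: "w = us @ replicate j (Suc n) @ vs" "Suc n \<notin> set us" "Suc n \<notin> set vs"
    using maximal_letter_contiguous[of w "Suc n"] w by (metis atLeastAtMost_iff subsetD)
  have "j = k"
    using w(2)[of "Suc n"] d by (simp add: count_list_replicate)
  then have ins: "w = insert_block k (Suc n) (us @ vs) (length us)"
    using d by (simp add: insert_block_def)
  have "subseq (us @ vs) w"
    unfolding d by (intro list_emb_append_mono) auto
  then have "\<forall>a b. subseq [a, b, a] (us @ vs) \<longrightarrow> a \<le> b"
    using w(3) subseq_order.trans by blast
  moreover have "count_list (us @ vs) i = k" if "i \<in> {1..n}" for i
    using w(2)[of i] that by (simp add: d count_list_replicate)
  moreover have "set (us @ vs) \<subseteq> {1..n}"
    using w(1) d by (fastforce simp: le_Suc_eq)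
  ultimately have "us @ vs \<in> stirling_perms k n"
    by (simp add: stirling_perms_subseq)
  with ins show "w \<in> (\<Union>w\<in>stirling_perms k n. insert_block k (Suc n) w ` {..length w})"
    by force
next
  fix w assume "w \<in> (\<Union>w\<in>stirling_perms k n. insert_block k (Suc n) w ` {..length w})"
  then obtain v i where v: "v \<in> stirling_perms k n" and w: "w = insert_block k (Suc n) v i"
    by auto
  have lt: "\<forall>y\<in>set v. y < Suc n" and v0: "set v \<subseteq> {1..n}"
    using v by (auto simp: stirling_perms_def)
  have "\<forall>a b. subseq [a, b, a] w \<longrightarrow> a \<le> b"
    using subseq_insert_block[OF lt] v unfolding w stirling_perms_subseq by blast
  moreover have "count_list w y = k" if "y \<in> {1..Suc n}" for y
  proof (cases "y = Suc n")
    case True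
    then show ?thesis using lt by (auto simp: w count_list_insert_block count_list_0_iff)
  next
    case False
    then show ?thesis using v that by (auto simp: w count_list_insert_block stirling_perms_def)
  qed
  moreover have "set w \<subseteq> {1..Suc n}"
    using v0 by (auto simp: w set_insert_block)
  ultimately show "w \<in> stirling_perms k (Suc n)"
    by (simp add: stirling_perms_subseq)
qed

subsection \<open>Ascents and descents\<close>

text \<open>One statistic for both cases: \<open>(<)\<close> yields ascents and \<open>(>)\<close>
  descents. Recursion over neighbours, unlike an index set, splits well along
  concatenations.\<close>

fun rises :: "('a \<Rightarrow> 'a \<Rightarrow> bool) \<Rightarrow> 'a list \<Rightarrow> nat" where
  "rises R (a # b # xs) = (if R a b then 1 else 0) + rises R (b # xs)"
| "rises R xs = 0"

lemma rises_conv_card: "rises R xs = card {i. Suc i < length xs \<and> R (xs ! i) (xs ! Suc i)}"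
proof (induction R xs rule: rises.induct)
  case (1 R a b xs)
  let ?S = "\<lambda>xs. {i. Suc i < length xs \<and> R (xs ! i) (xs ! Suc i)}"
  have fin: "finite (?S ys)" for ys
    by (rule finite_subset[of _ "{..<length ys}"]) auto
  have "?S (a # b # xs) = (if R a b then {0} else {}) \<union> Suc ` ?S (b # xs)"
  proof (intro equalityI subsetI)
    fix i assume "i \<in> ?S (a # b # xs)"
    then show "i \<in> (if R a b then {0} else {}) \<union> Suc ` ?S (b # xs)"
      by (cases i) auto
  qed (auto split: if_splits)
  then have "card (?S (a # b # xs)) = (if R a b then 1 else 0) + card (Suc ` ?S (b # xs))"
    using fin[of "b # xs"] by (auto simp: card_insert_if)
  then show ?case using 1 by (simp add: card_image)
qed auto

text \<open>The letter \<open>a\<close> is shared by both parts, so each neighbouring pair is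
  counted once.\<close>

lemma rises_append: "rises R (xs @ a # ys) = rises R (xs @ [a]) + rises R (a # ys)"
  by (induction R xs rule: rises.induct) (cases ys; auto)+

lemma rises_replicate:
  "\<not> R c c \<Longrightarrow> rises R (a # replicate (Suc j) c @ b # ys) =
    (if R a c then 1 else 0) + (if R c b then 1 else 0) + rises R (b # ys)"
  by (induction j arbitrary: a) auto

lemma rises_padded:
  "rises R (padded w) = card {i \<in> {0..length w}. R (padded w ! i) (padded w ! (i + 1))}"
  by (auto simp: rises_conv_card padded_def less_Suc_eq_le intro!: arg_cong[where f = card])

text \<open>The last assumption makes exactly one of the two new steps \<open>a, N\<close> and \<open>N, b\<close> a rise;
  it holds for both \<open>R = (<)\<close> and \<open>R = (>)\<close>.\<close>

lemma rises_insert_block: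
  assumes "\<forall>y\<in>set w. y < N" "0 < N" "0 < k" "i \<le> length w"
    and "\<not> R N N" "\<And>y z. y < N \<Longrightarrow> z < N \<Longrightarrow> R y N \<noteq> R N z"
  shows "rises R (padded (insert_block k N w i)) = rises R (padded w) +
    (if R (padded w ! i) (padded w ! (i + 1)) then 0 else 1)"
proof -
  \<comment> \<open>The letters \<open>a\<close> and \<open>b\<close> enclose the gap and may be
    padding zeros; \<open>0 < N\<close> keeps those below \<open>N\<close> as well.\<close>
  obtain us a where us: "0 # take i w = us @ [a]"
    by (metis rev_exhaust list.distinct(1))
  obtain b vs where vs: "drop i w @ [0] = b # vs"
    by (metis list.exhaust snoc_eq_iff_butlast)
  have len: "length us = i"
    using arg_cong[OF us, of length] assms(4) by simp
  have "padded w = (0 # take i w) @ (drop i w @ [0])"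
    by (simp add: padded_def)
  then have w: "padded w = us @ a # b # vs" unfolding us vs by simp
  have "padded (insert_block k N w i) = (0 # take i w) @ replicate k N @ (drop i w @ [0])"
    by (simp add: padded_def insert_block_def)
  then have w': "padded (insert_block k N w i) = us @ a # replicate k N @ b # vs"
    unfolding us vs by simp
  have "set (padded w) \<subseteq> {..<N}" using assms(1,2) by (auto simp: padded_def)
  then have ab: "a < N" "b < N" unfolding w by auto
  obtain j where k: "k = Suc j" using assms(3) by (cases k) auto
  have "rises R (padded (insert_block k N w i)) =
      rises R (us @ [a]) + ((if R a N then 1 else 0) + (if R N b then 1 else 0) + rises R (b # vs))"
    unfolding w' unfolding k by (simp only: rises_append[of R us a "replicate (Suc j) N @ b # vs"]
        rises_replicate[of R, OF assms(5)])
  moreover have "rises R (padded w) = rises R (us @ [a]) + ((if R a b then 1 else 0) + rises R (b # vs))"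
    unfolding w by (simp only: rises_append[of R us a "b # vs"] rises.simps)
  moreover have "padded w ! i = a" "padded w ! (i + 1) = b"
    unfolding w using len by (auto simp: nth_append)
  ultimately show ?thesis using assms(6)[OF ab] by auto
qed

section \<open>The recurrence for Stirling permutations\<close>

lemma sum_insert_block:
  fixes f :: "nat \<Rightarrow> real"
  assumes "\<forall>y\<in>set w. y < N" "0 < N" "0 < k"
    and "\<not> R N N" "\<And>y z. y < N \<Longrightarrow> z < N \<Longrightarrow> R y N \<noteq> R N z"
  shows "(\<Sum>v\<in>insert_block k N w ` {..length w}. f (rises R (padded v))) =
    real (rises R (padded w)) * f (rises R (padded w)) +
    (real (length w) + 1 - real (rises R (padded w))) * f (Suc (rises R (padded w)))"
proof -
  let ?r = "rises R (padded w)"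
  let ?P = "\<lambda>i. R (padded w ! i) (padded w ! (i + 1))"
  have r: "card ({..length w} \<inter> {i. ?P i}) = ?r"
    unfolding rises_padded by (rule arg_cong[where f = card]) auto
  have "card ({..length w} \<inter> {i. ?P i}) + card ({..length w} \<inter> - {i. ?P i}) = card {..length w}"
    by (subst card_Un_disjoint[symmetric]) (auto simp flip: Int_Un_distrib)
  then have nr: "real (card ({..length w} \<inter> - {i. ?P i})) = real (length w) + 1 - real ?r"
    unfolding r by simp
  have "inj_on (insert_block k N w) {..length w}"
    using assms(1,3) by (intro insert_block_inj) auto
  then have "(\<Sum>v\<in>insert_block k N w ` {..length w}. f (rises R (padded v))) =
      (\<Sum>i\<le>length w. f (rises R (padded (insert_block k N w i))))"
    by (simp add: sum.reindex)
  also have "\<dots> = (\<Sum>i\<le>length w. if ?P i then f ?r else f (Suc ?r))"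
    using assms by (intro sum.cong refl) (simp add: rises_insert_block)
  also have "\<dots> = real ?r * f ?r + (real (length w) + 1 - real ?r) * f (Suc ?r)"
    by (simp only: sum.If_cases finite_atMost sum_constant r nr)
  finally show ?thesis .
qed

text \<open>Filtering out the new letter recovers \<open>w\<close>, so the insertion sets are
  disjoint. The coefficient \<open>k n + 1\<close> equals the \<open>k m - (k - 1)\<close> of the
  trees at \<open>m = n + 1\<close>.\<close>

lemma sum_stirling_perms_Suc:
  fixes f :: "nat \<Rightarrow> real"
  assumes "0 < k" and R: "\<And>N. \<not> R N N" "\<And>y z N. y < N \<Longrightarrow> z < N \<Longrightarrow> R y N \<noteq> R N z"
  shows "(\<Sum>w\<in>stirling_perms k (Suc n). f (rises R (padded w))) =
    (\<Sum>w\<in>stirling_perms k n. real (rises R (padded w)) * f (rises R (padded w)) +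
      (real k * real n + 1 - real (rises R (padded w))) * f (Suc (rises R (padded w))))"
proof -
  have lt: "\<forall>y\<in>set w. y < Suc n" if "w \<in> stirling_perms k n" for w
    using that by (auto simp: stirling_perms_def)
  have "(\<Sum>w\<in>stirling_perms k (Suc n). f (rises R (padded w))) =
      (\<Sum>w\<in>stirling_perms k n.
        \<Sum>v\<in>insert_block k (Suc n) w ` {..length w}. f (rises R (padded v)))"
    unfolding stirling_perms_Suc
  proof (intro sum.UNION_disjoint finite_stirling_perms ballI impI)
    fix w v assume wv: "w \<in> stirling_perms k n" "v \<in> stirling_perms k n" "w \<noteq> v"
    have "filter (\<lambda>y. y \<noteq> Suc n) (insert_block k (Suc n) w i) = w"
      "filter (\<lambda>y. y \<noteq> Suc n) (insert_block k (Suc n) v i) = v" for i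
      using lt[OF wv(1)] lt[OF wv(2)] by (auto intro!: filter_insert_block)
    then have "insert_block k (Suc n) w i \<noteq> insert_block k (Suc n) v j" for i j
      using wv(3) by metis
    then show "insert_block k (Suc n) w ` {..length w} \<inter>
        insert_block k (Suc n) v ` {..length v} = {}"
      by auto
  qed auto
  also have "\<dots> = (\<Sum>w\<in>stirling_perms k n. real (rises R (padded w)) * f (rises R (padded w)) +
      (real k * real n + 1 - real (rises R (padded w))) * f (Suc (rises R (padded w))))"
  proof (intro sum.cong refl)
    fix w assume w: "w \<in> stirling_perms k n"
    show "(\<Sum>v\<in>insert_block k (Suc n) w ` {..length w}. f (rises R (padded v))) =
        real (rises R (padded w)) * f (rises R (padded w)) +
        (real k * real n + 1 - real (rises R (padded w))) * f (Suc (rises R (padded w)))"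
      using sum_insert_block[where R = R, OF lt[OF w] zero_less_Suc assms(1) R(1) R(2)]
      by (simp add: length_stirling_perms[OF w])
  qed
  finally show ?thesis .
qed

lemma card_stirling_perms_Suc:
  assumes "0 < k"
  shows "card (stirling_perms k (Suc n)) = (k * n + 1) * card (stirling_perms k n)"
proof -
  \<comment> \<open>For a constant test function the two terms merge into the factor
    \<open>k n + 1\<close>, whatever the number of rises.\<close>
  have "real (card (stirling_perms k (Suc n))) = real ((k * n + 1) * card (stirling_perms k n))"
    using sum_stirling_perms_Suc[of k "(<)" "\<lambda>_. 1" n] assms by (simp add: algebra_simps)
  then show ?thesis by (simp only: of_nat_eq_iff)
qed

lemma card_stirling_perms:
  assumes "0 < k"
  shows "card (stirling_perms k (Suc n)) = (\<Prod>i = 1..n. (k * i + 1))"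
proof (induction n)
  case 0
  show ?case using card_stirling_perms_Suc[OF assms, of 0] by (simp add: stirling_perms_0)
next
  case (Suc n)
  show ?case
    using card_stirling_perms_Suc[OF assms, of "Suc n"] Suc by simp
qed

subsection \<open>Comparison\<close>

text \<open>The induction starts at word order 1: at order 0 the one-vertex tree has one leaf while
  the empty word has no rise.\<close>

lemma sum_leaves_eq_sum_rises:
  fixes f :: "nat \<Rightarrow> real"
  assumes "0 < k" and R: "\<And>N. \<not> R N N" "\<And>y z N. y < N \<Longrightarrow> z < N \<Longrightarrow> R y N \<noteq> R N z"
  shows "(\<Sum>t\<in>increasing_trees (Suc (Suc n)). weight k t * f (leaves t)) =
    (\<Sum>w\<in>stirling_perms k (Suc n). f (rises R (padded w)))"
proof (induction n arbitrary: f)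
  case 0
  have "increasing_trees (Suc 0) = {Node 1 []}"
    using increasing_trees_1 by simp
  moreover have "rises R (padded []) = 0"
    using R(1) by (simp add: padded_def)
  \<comment> \<open>Both sides equal \<open>f 1\<close>: the only insertion is at a leaf,
    respectively at a gap that is not a rise.\<close>
  ultimately show ?case
    using sum_stirling_perms_Suc[of k R f 0] sum_increasing_trees_Suc[of 1 k f] assms
    by (simp add: stirling_perms_0 phi_def)
next
  case (Suc n)
  \<comment> \<open>One step of the common recurrence, moved onto the test function; hence the
    induction over arbitrary \<open>f\<close>.\<close>
  let ?g = "\<lambda>j. real j * f j + (real k * real (Suc n) + 1 - real j) * f (Suc j)"
  have "(\<Sum>t\<in>increasing_trees (Suc (Suc (Suc n))). weight k t * f (leaves t)) =
      (\<Sum>t\<in>increasing_trees (Suc (Suc n)). weight k t * ?g (leaves t))"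
    by (subst sum_increasing_trees_Suc) (simp_all add: algebra_simps)
  also have "\<dots> = (\<Sum>w\<in>stirling_perms k (Suc n). ?g (rises R (padded w)))"
    by (rule Suc)
  also have "\<dots> = (\<Sum>w\<in>stirling_perms k (Suc (Suc n)). f (rises R (padded w)))"
    by (rule sum_stirling_perms_Suc[of k R f "Suc n", OF assms, symmetric])
  finally show ?case .
qed

section \<open>From weighted sums to probability distributions\<close>

lemma pmf_map_finite:
  assumes "finite A" "set_pmf p \<subseteq> A"
  shows "pmf (map_pmf g p) j = (\<Sum>x\<in>A. pmf p x * of_bool (g x = j))"
proof -
  have "pmf (map_pmf g p) j = measure_pmf.expectation p (indicator (g -` {j}))"
    by (simp add: pmf_map)
  also have "\<dots> = (\<Sum>x\<in>A. indicator (g -` {j}) x * pmf p x)"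
    using assms by (intro integral_measure_pmf_real) auto
  also have "\<dots> = (\<Sum>x\<in>A. pmf p x * of_bool (g x = j))"
    by (intro sum.cong refl) (auto simp: indicator_def)
  finally show ?thesis .
qed

lemma map_pmf_leaves_eq_rises:
  assumes "0 < k" and R: "\<And>N. \<not> R N N" "\<And>y z N. y < N \<Longrightarrow> z < N \<Longrightarrow> R y N \<noteq> R N z"
  shows "map_pmf leaves (random_tree k (Suc (Suc n))) =
    map_pmf (\<lambda>w. rises R (padded w)) (pmf_of_set (stirling_perms k (Suc n)))"
proof (rule pmf_eqI)
  fix j
  let ?T = "increasing_trees (Suc (Suc n))" and ?S = "stirling_perms k (Suc n)"
  have S: "?S \<noteq> {}"
    using card_stirling_perms[OF assms(1), of n] by auto
  \<comment> \<open>The test function 1 identifies the normalising constants; the indicator of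
    \<open>j\<close> will give the mass at \<open>j\<close>.\<close>
  have total: "total_weight k (Suc (Suc n)) = real (card ?S)"
    using sum_leaves_eq_sum_rises[where R = R and n = n and f = "\<lambda>_. 1", OF assms]
    by (simp add: total_weight_def)
  have pmf: "pmf (random_tree k (Suc (Suc n))) t =
      (if t \<in> ?T then weight k t / real (card ?S) else 0)" for t
    using assms(1) by (simp add: pmf_random_tree flip: total)
  have "pmf (map_pmf leaves (random_tree k (Suc (Suc n)))) j =
      (\<Sum>t\<in>?T. pmf (random_tree k (Suc (Suc n))) t * of_bool (leaves t = j))"
    by (intro pmf_map_finite finite_increasing_trees) (auto simp: set_pmf_eq pmf split: if_splits)
  also have "\<dots> = (\<Sum>t\<in>?T. weight k t * of_bool (leaves t = j)) / real (card ?S)"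
    unfolding sum_divide_distrib by (intro sum.cong refl) (simp add: pmf)
  also have "\<dots> = (\<Sum>w\<in>?S. of_bool (rises R (padded w) = j)) / real (card ?S)"
    using sum_leaves_eq_sum_rises[where R = R and n = n and f = "\<lambda>i. of_bool (i = j)", OF assms]
    by simp
  also have "\<dots> = (\<Sum>w\<in>?S. pmf (pmf_of_set ?S) w * of_bool (rises R (padded w) = j))"
    unfolding sum_divide_distrib using S by (intro sum.cong refl) (simp add: finite_stirling_perms)
  also have "\<dots> = pmf (map_pmf (\<lambda>w. rises R (padded w)) (pmf_of_set ?S)) j"
    using S by (intro pmf_map_finite[symmetric]) (auto simp: finite_stirling_perms)
  finally show "pmf (map_pmf leaves (random_tree k (Suc (Suc n)))) j =
      pmf (map_pmf (\<lambda>w. rises R (padded w)) (pmf_of_set ?S)) j" .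
qed

lemma ascents_conv_rises: "ascents = (\<lambda>w. rises (<) (padded w))"
  by (simp add: ascents_def rises_padded fun_eq_iff)

lemma descents_conv_rises: "descents = (\<lambda>w. rises (>) (padded w))"
  by (simp add: descents_def rises_padded fun_eq_iff)

theorem theorem3p9:
  fixes k n :: nat
  assumes "k \<ge> 2" and "n \<ge> 1"
  shows "card (stirling_perms k n) = (\<Prod>i = 1..n - 1. (k * i + 1)) \<and>
    total_weight k (n + 1) = real (card (stirling_perms k n)) \<and>
    map_pmf leaves (random_tree k (n + 1)) = map_pmf ascents (pmf_of_set (stirling_perms k n)) \<and>
    map_pmf leaves (random_tree k (n + 1)) = map_pmf descents (pmf_of_set (stirling_perms k n))"
proof -
  obtain m where n: "n = Suc m" using assms(2) by (cases n) auto
  have k: "0 < k" using assms(1) by simp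
  have "total_weight k (Suc (Suc m)) = real (card (stirling_perms k (Suc m)))"
    using sum_leaves_eq_sum_rises[where R = "(<)" and n = m and k = k and f = "\<lambda>_. 1"] k
    by (simp add: total_weight_def)
  \<comment> \<open>For \<open>(<)\<close> only the step into a block is a rise, for
    \<open>(>)\<close> only the step out of it, so both relations qualify as
    \<open>R\<close>.\<close>
  then show ?thesis
    using card_stirling_perms[OF k, of m] map_pmf_leaves_eq_rises[of k "(<)" m]
      map_pmf_leaves_eq_rises[of k "(>)" m] k
    by (simp add: n ascents_conv_rises descents_conv_rises)
qed

end
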